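(* For all integers $r,k\in\mathbb{Z}$ and all integers $n\ge 0$ and $s\ge 0$, $$s_{n}^{(r,k)}(x)=\frac{1}{2^{s}}\sum_{m=0}^{n}\left\{\binom{n}{m}\sum_{j=0}^{s}\binom{s}{j}s_{n-m}^{(r,k)}(j)\right\}E_{m}^{(s)}(x)$$ as polynomials in $x$.
   Context: For $k\in\mathbb{Z}$, $Li_k(x)=\sum_{n=1}^{\infty}\frac{x^n}{n^k}$ is the polylogarithm, regarded as a formal power series; $\frac{Li_k(1-e^{-t})}{1-e^{-t}}$ is then a formal power series in $t$ over $\mathbb{C}$. For $r,k\in\mathbb{Z}$, the higher-order Bernoulli and poly-Bernoulli mixed type polynomials $s_n^{(r,k)}(x)$ are defined by $\left(\frac{t}{e^t-1}\right)^r\frac{Li_k(1-e^{-t})}{1-e^{-t}}e^{xt}=\sum_{n\ge0}s_n^{(r,k)}(x)\frac{t^n}{n!}$; $s_{n-m}^{(r,k)}(j)$ is the value of the polynomial at $x=j$. $E_n^{(s)}(x)$ (the Euler polynomials of order $s$) is the Sheffer sequence for the pair $\left(\left(\frac{e^t+1}{2}\right)^s,\,t\right)$; equivalently, $\left(\frac{2}{e^t+1}\right)^s e^{xt}=\sum_{n\ge0}E_n^{(s)}(x)\frac{t^n}{n!}$. *)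

theory Defs
  imports "HOL-Computational_Algebra.Computational_Algebra" Complex_Main
begin

definition fps_polylog :: "int \<Rightarrow> complex fps" where
  "fps_polylog k = Abs_fps (\<lambda>n. if n = 0 then 0 else 1 / of_nat n powi k)"

text \<open>The embedding of \<open>\<complex>[[t]]\<close> into \<open>\<complex>[x][[t]]\<close>.\<close>

definition fps_const_coeffs :: "complex fps \<Rightarrow> complex poly fps" where
  "fps_const_coeffs F = Abs_fps (\<lambda>n. [:fps_nth F n:])"

text \<open>The series \<open>e^(xt)\<close> in \<open>\<complex>[x][[t]]\<close>.\<close>

definition fps_exp_xt :: "complex poly fps" where
  "fps_exp_xt = Abs_fps (\<lambda>n. smult (1 / fact n) ([:0, 1:] ^ n))"

text \<open>The polynomials \<open>p_n(x)\<close> with \<open>F(t) e^(xt) = (\<Sum>n\<ge>0. p_n(x) t^n / n!)\<close> in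
  \<open>\<complex>[x][[t]]\<close>.\<close>

definition appell_poly :: "complex fps \<Rightarrow> nat \<Rightarrow> complex poly" where
  "appell_poly F n = smult (fact n) (fps_nth (fps_const_coeffs F * fps_exp_xt) n)"

text \<open>Both quotients below are exact in \<open>\<complex>[[t]]\<close>, and the base of the integer power is a unit
  (see \<open>bernoulli_base_mult\<close>, \<open>bernoulli_base_unit\<close> and \<open>polylog_quotient_mult\<close>).\<close>

definition bernoulli_polybernoulli_poly :: "int \<Rightarrow> int \<Rightarrow> nat \<Rightarrow> complex poly" where
  "bernoulli_polybernoulli_poly r k =
     appell_poly ((fps_X / (fps_exp 1 - 1)) powi r *
       ((fps_polylog k oo (1 - fps_exp (-1))) / (1 - fps_exp (-1))))"

definition euler_poly :: "nat \<Rightarrow> nat \<Rightarrow> complex poly" where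
  "euler_poly s = appell_poly ((2 / (fps_exp 1 + 1)) ^ s)"

lemma bernoulli_base_mult:
  "(fps_X / (fps_exp 1 - 1)) * (fps_exp 1 - 1) = (fps_X :: complex fps)"
proof -
  have sd: "subdegree (fps_exp (1::complex) - 1) = 1"
    by (rule subdegreeI) auto
  then have "fps_exp (1::complex) - 1 \<noteq> 0" by force
  then have "(fps_exp (1::complex) - 1) dvd fps_X"
    by (subst fps_dvd_iff) (simp_all only: sd fps_X_neq_zero fps_X_nth subdegree_fps_X order.refl not_False_eq_True)
  then show ?thesis by simp
qed

lemma bernoulli_base_unit:
  "fps_nth (fps_X / (fps_exp 1 - 1) :: complex fps) 0 = 1"
proof -
  have "fps_nth ((fps_X / (fps_exp 1 - 1)) * (fps_exp 1 - 1)) 1 = (1::complex)"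
    by (subst bernoulli_base_mult) simp
  then show ?thesis by (simp add: fps_mult_nth)
qed

lemma polylog_quotient_mult:
  "(fps_polylog k oo (1 - fps_exp (-1))) / (1 - fps_exp (-1)) * (1 - fps_exp (-1)) =
     fps_polylog k oo (1 - fps_exp (-1))"
proof -
  have sd: "subdegree (1 - fps_exp (-1::complex)) = 1"
    by (rule subdegreeI) auto
  then have nz: "1 - fps_exp (-1::complex) \<noteq> 0" by force
  have "(1 - fps_exp (-1::complex)) dvd (fps_polylog k oo (1 - fps_exp (-1)))"
  proof (cases "fps_polylog k oo (1 - fps_exp (-1)) = 0")
    case False
    moreover have "fps_nth (fps_polylog k oo (1 - fps_exp (-1))) 0 = 0"
      by (simp add: fps_polylog_def)
    ultimately have "subdegree (fps_polylog k oo (1 - fps_exp (-1))) \<noteq> 0"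
      by (metis subdegree_eq_0_iff)
    with False nz show ?thesis by (simp only: fps_dvd_iff[OF nz False] sd)
  qed simp
  then show ?thesis by simp
qed

lemma coeff_appell_poly:
  "coeff (appell_poly F n) i = (if i \<le> n then fact n / fact i * fps_nth F (n - i) else 0)"
proof -
  have "coeff (appell_poly F n) i =
      fact n * (\<Sum>j=0..n. fps_nth F j * (1 / fact (n - j) * (if i = n - j then 1 else 0)))"
    by (simp add: appell_poly_def fps_mult_nth coeff_sum fps_const_coeffs_def fps_exp_xt_def
        flip: monom_altdef[of 1, simplified])
      (rule sum.cong, auto)
  also have "(\<Sum>j=0..n. fps_nth F j * (1 / fact (n - j) * (if i = n - j then 1 else 0))) =
      (\<Sum>j=0..n. if j = n - i then (if i \<le> n then fps_nth F j / fact i else 0) else 0)"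
    by (rule sum.cong) auto
  finally show ?thesis by simp
qed

text \<open>The Appell polynomials of \<open>1 / g\<close> are the Sheffer sequence for \<open>(g, t)\<close> in the sense of
  umbral calculus: \<open>\<langle>g(t) t^m | p_n(x)\<rangle> = n! \<delta>(n,m)\<close>, where \<open>\<langle>t^i | x^j\<rangle> = j! \<delta>(i,j)\<close>.\<close>

definition umbral_pairing :: "complex fps \<Rightarrow> complex poly \<Rightarrow> complex" where
  "umbral_pairing f p = (\<Sum>i\<le>degree p. fact i * fps_nth f i * coeff p i)"

lemma umbral_pairing_appell_poly:
  assumes "g * F = 1"
  shows "umbral_pairing (g * fps_X ^ m) (appell_poly F n) = (if n = m then fact n else 0)"
proof -
  have deg: "degree (appell_poly F n) \<le> n"
    by (rule degree_le) (simp add: coeff_appell_poly)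
  have "umbral_pairing (g * fps_X ^ m) (appell_poly F n) =
      (\<Sum>i=0..n. fact i * fps_nth (g * fps_X ^ m) i * coeff (appell_poly F n) i)"
    unfolding umbral_pairing_def using deg
    by (intro sum.mono_neutral_left) (auto simp: coeff_eq_0)
  also have "\<dots> = fact n * (\<Sum>i=0..n. fps_nth (g * fps_X ^ m) i * fps_nth F (n - i))"
    unfolding sum_distrib_left by (rule sum.cong) (auto simp: coeff_appell_poly)
  also have "\<dots> = fact n * fps_nth (g * fps_X ^ m * F) n"
    by (simp only: fps_mult_nth[of "g * fps_X ^ m" F])
  also have "g * fps_X ^ m * F = fps_X ^ m"
    using assms by (metis mult.commute mult.left_commute mult_1_right)
  finally show ?thesis by simp
qed

lemma euler_poly_sheffer:
  "umbral_pairing (((fps_exp 1 + 1) / 2) ^ s * fps_X ^ m) (euler_poly s n) =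
     (if n = m then fact n else 0)"
proof -
  have "((fps_exp 1 + 1) / 2) * (2 / (fps_exp 1 + 1)) = (1 :: complex fps)"
  proof -
    have "inverse (fps_exp 1 + 1) * (fps_exp 1 + 1) = (1 :: complex fps)"
      by (rule inverse_mult_eq_1) simp
    moreover have "inverse 2 * 2 = (1 :: complex fps)"
      by (rule inverse_mult_eq_1) simp
    ultimately show ?thesis
      by (simp add: fps_divide_unit ac_simps)
  qed
  then show ?thesis
    unfolding euler_poly_def
    by (intro umbral_pairing_appell_poly) (simp flip: power_mult_distrib)
qed

end

theory Submission
  imports Defs
begin

text \<open>Multiplying the generating series
  \<open>F(t) e^(xt)\<close> by \<open>1 = 2^(-s) (e^t + 1)^s (2 / (e^t + 1))^s\<close> exhibits it as the product of
  \<open>F(t) (e^t + 1)^s\<close> and the generating series of the Euler polynomials. By the binomial theorem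
  \<open>F(t) (e^t + 1)^s\<close> is the sum of the \<open>(s choose j) F(t) e^(jt)\<close>, and \<open>F(t) e^(jt)\<close> generates
  the values at \<open>x = j\<close>.\<close>

lemma fps_const_coeffs_mult:
  "fps_const_coeffs (F * G) = fps_const_coeffs F * fps_const_coeffs G"
proof (rule fps_ext)
  have "[:\<Sum>i\<in>A. f i:] = (\<Sum>i\<in>A. [:f i:])" for f :: "nat \<Rightarrow> complex" and A
    by (rule poly_eqI) (simp add: coeff_sum coeff_pCons split: nat.split)
  then show "fps_nth (fps_const_coeffs (F * G)) n =
      fps_nth (fps_const_coeffs F * fps_const_coeffs G) n" for n
    by (simp add: fps_const_coeffs_def fps_mult_nth mult.commute)
qed

lemma smult_sum_right:
  "smult c (\<Sum>i\<in>A. p i) = (\<Sum>i\<in>A. smult c (p i))"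
  by (rule poly_eqI) (simp add: coeff_sum sum_distrib_left)

text \<open>The variable x enters only through e^(xt), so F G e^(xt) is the Cauchy product of F with
  G e^(xt). The binomial coefficient arises from n! = (n choose m) (n-m)! m!.\<close>

lemma appell_poly_mult:
  "appell_poly (F * G) n =
    (\<Sum>m=0..n. smult (of_nat (n choose m) * (fact (n - m) * fps_nth F (n - m)))
      (appell_poly G m))"
proof -
  have "appell_poly (F * G) n =
      smult (fact n) (fps_nth (fps_const_coeffs G * fps_exp_xt * fps_const_coeffs F) n)"
    by (simp add: appell_poly_def fps_const_coeffs_mult ac_simps)
  also have "\<dots> = (\<Sum>m=0..n. smult (fact n * fps_nth F (n - m))
      (fps_nth (fps_const_coeffs G * fps_exp_xt) m))"
    \<comment> \<open>The instantiation expands only the outer product, keeping the coefficients of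
      G e^(xt) intact.\<close>
    unfolding fps_mult_nth[of "_ * fps_exp_xt"]
    by (simp add: fps_const_coeffs_def smult_sum_right mult.commute)
  also have "\<dots> = (\<Sum>m=0..n. smult (of_nat (n choose m) * (fact (n - m) * fps_nth F (n - m)))
      (appell_poly G m))"
    by (rule sum.cong) (auto simp: appell_poly_def binomial_fact)
  finally show ?thesis .
qed

text \<open>Evaluation at c is a ring homomorphism on each coefficient and turns e^(xt) into
  e^(ct).\<close>

lemma poly_appell_poly:
  "poly (appell_poly F n) c = fact n * fps_nth (F * fps_exp c) n"
proof -
  have "poly (fps_nth (fps_const_coeffs F * fps_exp_xt) n) c = fps_nth (F * fps_exp c) n"
    by (simp add: fps_mult_nth poly_sum fps_const_coeffs_def fps_exp_xt_def)
  then show ?thesis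
    by (simp add: appell_poly_def)
qed

lemma fps_exp_plus_one_power:
  "(fps_exp 1 + 1) ^ s = (\<Sum>j=0..s. of_nat (s choose j) * fps_exp (of_nat j :: complex))"
  by (simp add: binomial_ring fps_exp_power_mult atLeast0AtMost)

lemma appell_poly_euler_expansion:
  "appell_poly F n =
    smult (1 / 2 ^ s)
      (\<Sum>m=0..n.
        smult (of_nat (n choose m) *
            (\<Sum>j=0..s. of_nat (s choose j) * poly (appell_poly F (n - m)) (of_nat j)))
          (euler_poly s m))"
proof -
  \<comment> \<open>The right-hand side is the weight that \<open>appell_poly_mult\<close> attaches
    when its first factor is F (e^t + 1)^s.\<close>
  have pairing: "(\<Sum>j=0..s. of_nat (s choose j) * poly (appell_poly F i) (of_nat j)) =
      fact i * fps_nth (F * (fps_exp 1 + 1) ^ s) i" for i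
  proof -
    have "fps_nth (F * (of_nat a * G)) i = of_nat a * fps_nth (F * G) i" for a G
      by (simp add: mult.left_commute[of F] flip: fps_of_nat)
    then show ?thesis
      by (simp add: poly_appell_poly fps_exp_plus_one_power sum_distrib_left fps_sum_nth
          mult.left_commute)
  qed
  \<comment> \<open>The constant term of e^t + 1 is 2, so it is a unit and the quotient is
    exact.\<close>
  have "(fps_exp 1 + 1) * (2 / (fps_exp 1 + 1)) = (fps_const 2 :: complex fps)"
    using inverse_mult_eq_1[of "fps_exp 1 + 1 :: complex fps"]
    by (simp add: fps_divide_unit ac_simps numeral_fps_const)
  then have "(fps_exp 1 + 1) ^ s * (2 / (fps_exp 1 + 1)) ^ s = (fps_const (2 ^ s) :: complex fps)"
    by (metis power_mult_distrib fps_const_power)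
  then have "appell_poly (F * (fps_exp 1 + 1) ^ s * (2 / (fps_exp 1 + 1)) ^ s) n =
      smult (2 ^ s) (appell_poly F n)"
    by (intro poly_eqI) (simp add: mult.assoc coeff_appell_poly)
  then show ?thesis
    \<comment> \<open>Read backwards, the product formula collapses the sum to 2^s times the
      polynomial of F.\<close>
    unfolding pairing euler_poly_def by (simp flip: appell_poly_mult)
qed

theorem theorem8:
  fixes r k :: int and n s :: nat
  shows "bernoulli_polybernoulli_poly r k n =
    smult (1 / 2 ^ s)
      (\<Sum>m=0..n.
        smult (of_nat (n choose m) *
            (\<Sum>j=0..s. of_nat (s choose j) *
               poly (bernoulli_polybernoulli_poly r k (n - m)) (of_nat j)))
          (euler_poly s m))"
  unfolding bernoulli_polybernoulli_poly_def by (rule appell_poly_euler_expansion)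

end
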